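(* For a Tychonoff space $X$ the following conditions are equivalent: (1) $X$ is discrete; (2) $X$ is zero-dimensional, $k$-discrete, countably tight and contains no $\mathrm{Clop}^\omega$-fans; (3) $X$ is zero-dimensional, $k$-discrete, and contains no $\mathrm{Clop}$-fans; (4) $X$ is $k$-discrete and contains no strict $\mathrm{Cld}^\omega$-fans and no $\mathrm{Clop}$-fans.
   Context: $X$ is zero-dimensional if its clopen (closed-and-open) subsets form a base of the topology. $X$ is $k$-discrete if every compact subset of $X$ is finite. $X$ is countably tight if for every $A\subset X$ and $a\in\overline A$ there is a countable $B\subset A$ with $a\in\overline B$. Let $\lambda$ be a cardinal. A family $(F_\alpha)_{\alpha\in\lambda}$ of subsets of $X$ is locally finite if each $x\in X$ has a neighborhood $O_x$ such that $\{\alpha\in\lambda: O_x\cap F_\alpha\neq\emptyset\}$ is finite; it is compact-finite if for each compact $K\subset X$ the set $\{\alpha\in\lambda: K\cap F_\alpha\ne\emptyset\}$ is finite. A $\lambda$-fan in $X$ is a family $(F_\alpha)_{\alpha\in\lambda}$ of subsets of $X$ which is compact-finite but not locally finite. A set $U\subset X$ is a functional neighborhood of a set $A\subset X$ if there is a continuous $f:X\to[0,1]$ with $f(A)\subset\{0\}$ and $f(X\setminus U)\subset\{1\}$. The fan $(F_\alpha)_{\alpha\in\lambda}$ is strict if each $F_\alpha$ has a functional neighborhood $U_\alpha\subset X$ such that the family $(U_\alpha)_{\alpha\in\lambda}$ is compact-finite. A $\mathrm{Clop}^\lambda$-fan (resp. $\mathrm{Cld}^\lambda$-fan) is a $\lambda$-fan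 all of whose members are clopen (resp. closed) subsets of $X$. A $\mathrm{Clop}$-fan is a $\mathrm{Clop}^\lambda$-fan for some cardinal $\lambda$. *)

theory Defs
  imports "HOL-Analysis.Analysis"
begin

definition tychonoff_space :: "'a topology \<Rightarrow> bool" where
  "tychonoff_space X \<longleftrightarrow> completely_regular_space X \<and> Hausdorff_space X"

definition clopenin :: "'a topology \<Rightarrow> 'a set \<Rightarrow> bool" where
  "clopenin X U \<longleftrightarrow> openin X U \<and> closedin X U"

definition zero_dimensional_space :: "'a topology \<Rightarrow> bool" where
  "zero_dimensional_space X \<longleftrightarrow> openin X = arbitrary union_of (clopenin X)"

definition k_discrete_space :: "'a topology \<Rightarrow> bool" where
  "k_discrete_space X \<longleftrightarrow> (\<forall>K. compactin X K \<longrightarrow> finite K)"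

definition countably_tight_space :: "'a topology \<Rightarrow> bool" where
  "countably_tight_space X \<longleftrightarrow>
     (\<forall>A a. A \<subseteq> topspace X \<and> a \<in> X closure_of A \<longrightarrow>
        (\<exists>B\<subseteq>A. countable B \<and> a \<in> X closure_of B))"

(* A cardinal is a cardinal well-order in the sense of Card_order, and a family of sets
   indexed by the cardinal lam is a function restricted to Field lam.  The library's
   locally_finite_in concerns sets of sets; the notions below concern indexed families,
   so repeated members count with multiplicity. *)

definition locally_finite_family :: "'i rel \<Rightarrow> 'a topology \<Rightarrow> ('i \<Rightarrow> 'a set) \<Rightarrow> bool" where
  "locally_finite_family lam X F \<longleftrightarrow>
     (\<forall>x\<in>topspace X. \<exists>W. openin X W \<and> x \<in> W \<and>
        finite {\<alpha>\<in>Field lam. W \<inter> F \<alpha> \<noteq> {}})"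

definition compact_finite_family :: "'i rel \<Rightarrow> 'a topology \<Rightarrow> ('i \<Rightarrow> 'a set) \<Rightarrow> bool" where
  "compact_finite_family lam X F \<longleftrightarrow>
     (\<forall>K. compactin X K \<longrightarrow> finite {\<alpha>\<in>Field lam. K \<inter> F \<alpha> \<noteq> {}})"

definition fan :: "'i rel \<Rightarrow> 'a topology \<Rightarrow> ('i \<Rightarrow> 'a set) \<Rightarrow> bool" where
  "fan lam X F \<longleftrightarrow>
     (\<forall>\<alpha>\<in>Field lam. F \<alpha> \<subseteq> topspace X) \<and>
     compact_finite_family lam X F \<and> \<not> locally_finite_family lam X F"

definition functional_neighborhood :: "'a topology \<Rightarrow> 'a set \<Rightarrow> 'a set \<Rightarrow> bool" where
  "functional_neighborhood X U A \<longleftrightarrow>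
     U \<subseteq> topspace X \<and>
     (\<exists>f. continuous_map X (top_of_set {0..1::real}) f \<and>
          f ` A \<subseteq> {0} \<and> f ` (topspace X - U) \<subseteq> {1})"

definition strict_fan :: "'i rel \<Rightarrow> 'a topology \<Rightarrow> ('i \<Rightarrow> 'a set) \<Rightarrow> bool" where
  "strict_fan lam X F \<longleftrightarrow>
     fan lam X F \<and>
     (\<exists>U. (\<forall>\<alpha>\<in>Field lam. functional_neighborhood X (U \<alpha>) (F \<alpha>)) \<and>
          compact_finite_family lam X U)"

definition Clop_fan :: "'i rel \<Rightarrow> 'a topology \<Rightarrow> ('i \<Rightarrow> 'a set) \<Rightarrow> bool" where
  "Clop_fan lam X F \<longleftrightarrow> fan lam X F \<and> (\<forall>\<alpha>\<in>Field lam. clopenin X (F \<alpha>))"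

definition strict_Cld_fan :: "'i rel \<Rightarrow> 'a topology \<Rightarrow> ('i \<Rightarrow> 'a set) \<Rightarrow> bool" where
  "strict_Cld_fan lam X F \<longleftrightarrow> strict_fan lam X F \<and> (\<forall>\<alpha>\<in>Field lam. closedin X (F \<alpha>))"

(* A formula cannot quantify over the type carrying the cardinal lam, so that type is a
   parameter 'i, added as a summand to 'a \<times> nat.  A statement with 'i free covers every
   cardinal, however large.  No instance of 'i is too small: singletons are compact, so
   each point lies in only finitely many members of a fan, hence the nonempty members
   are indexed by a set that injects into 'a \<times> nat, and empty members do not affect
   whether a family is a fan. *)
definition contains_Clop_fan :: "'i itself \<Rightarrow> 'a topology \<Rightarrow> bool" where
  "contains_Clop_fan _ X \<longleftrightarrow>
     (\<exists>(lam :: ('a \<times> nat + 'i) rel) F. Card_order lam \<and> Clop_fan lam X F)"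

end

theory Submission
  imports Defs
begin

text \<open>
  In a k-discrete space compact-finite means point-finite, so a disjoint family of clopen sets that
  accumulates at a point outside its union is a Clop-fan. In a zero-dimensional space, a maximal
  disjoint family of clopen sets missing a non-isolated point \<open>x\<close> accumulates at \<open>x\<close>; under
  countable tightness the family can be chosen countable. Finally, if a k-discrete space has no
  strict \<open>Cld\<^sup>\<omega>\<close>-fans, then every zero set \<open>{f = 0}\<close> is open: otherwise the sets
  \<open>{\<bar>1 - n f\<bar> \<le> f}\<close>, i.e. \<open>{\<bar>1/f - n\<bar> \<le> 1}\<close>, form such a fan. Hence a
  Tychonoff space of this kind is zero-dimensional.
\<close>

section \<open>Clop-fans from disjoint clopen families\<close>

lemma zero_dimensional_space_iff:
  "zero_dimensional_space X \<longleftrightarrow>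
     (\<forall>U x. openin X U \<and> x \<in> U \<longrightarrow> (\<exists>V. clopenin X V \<and> x \<in> V \<and> V \<subseteq> U))"
  unfolding zero_dimensional_space_def openin_topology_base_unique
  by (auto simp: clopenin_def)

lemma compact_finite_familyI:
  assumes "k_discrete_space X"
    and "\<And>x. x \<in> topspace X \<Longrightarrow> finite {\<alpha>\<in>Field lam. x \<in> F \<alpha>}"
  shows "compact_finite_family lam X F"
  unfolding compact_finite_family_def
proof (intro allI impI)
  fix K assume K: "compactin X K"
  then have "K \<subseteq> topspace X" "finite K"
    using assms(1) by (auto simp: k_discrete_space_def compactin_subset_topspace)
  then have "finite (\<Union>x\<in>K. {\<alpha>\<in>Field lam. x \<in> F \<alpha>})"
    using assms(2) by blast
  then show "finite {\<alpha>\<in>Field lam. K \<inter> F \<alpha> \<noteq> {}}"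
    by (rule rev_finite_subset) auto
qed

text \<open>Disjointness puts each point in at most one member, which gives point-finiteness. If
  some neighborhood of \<open>x\<close> met only finitely many members, removing these closed sets
  from it would leave a neighborhood of \<open>x\<close> missing the whole union, although
  \<open>x\<close> lies in the closure of that union.\<close>

lemma Clop_fan_disjoint_family:
  assumes kd: "k_discrete_space X"
    and clop: "\<And>\<alpha>. \<alpha> \<in> Field lam \<Longrightarrow> clopenin X (F \<alpha>)"
    and disj: "disjoint_family_on F (Field lam)"
    and acc: "x \<in> X closure_of (\<Union>\<alpha>\<in>Field lam. F \<alpha>)"
    and notin: "x \<notin> (\<Union>\<alpha>\<in>Field lam. F \<alpha>)"
  shows "Clop_fan lam X F"
proof -
  have "compact_finite_family lam X F"
  proof (rule compact_finite_familyI [OF kd])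
    fix y
    show "finite {\<alpha>\<in>Field lam. y \<in> F \<alpha>}"
    proof (cases "\<exists>\<alpha>\<in>Field lam. y \<in> F \<alpha>")
      case True
      then obtain \<alpha> where "\<alpha> \<in> Field lam" "y \<in> F \<alpha>" by blast
      then have "{\<alpha>\<in>Field lam. y \<in> F \<alpha>} \<subseteq> {\<alpha>}"
        using disj by (auto simp: disjoint_family_on_def)
      then show ?thesis by (rule finite_subset) simp
    next
      case False
      then have "{\<alpha>\<in>Field lam. y \<in> F \<alpha>} = {}" by blast
      then show ?thesis by (simp only: finite.emptyI)
    qed
  qed
  moreover have "\<not> locally_finite_family lam X F"
  proof
    assume "locally_finite_family lam X F"
    then obtain W where W: "openin X W" "x \<in> W" and
      fin: "finite {\<alpha>\<in>Field lam. W \<inter> F \<alpha> \<noteq> {}}" (is "finite ?I")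
      using acc unfolding locally_finite_family_def by (meson in_closure_of)
    have "closedin X (\<Union>\<alpha>\<in>?I. F \<alpha>)"
      using fin clop by (intro closedin_Union) (auto simp: clopenin_def)
    then have "openin X (W - (\<Union>\<alpha>\<in>?I. F \<alpha>))"
      using W by blast
    moreover have "x \<in> W - (\<Union>\<alpha>\<in>?I. F \<alpha>)"
      using notin W by blast
    ultimately obtain y where "y \<in> (\<Union>\<alpha>\<in>Field lam. F \<alpha>)" "y \<in> W - (\<Union>\<alpha>\<in>?I. F \<alpha>)"
      using acc unfolding in_closure_of by meson
    then show False by blast
  qed
  ultimately show ?thesis
    using clop unfolding Clop_fan_def fan_def clopenin_def by (auto dest: openin_subset)
qed

section \<open>Non-isolated points of zero-dimensional spaces\<close>

lemma not_isolated_in_closure: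
  assumes "x \<in> topspace X" "\<not> openin X {x}"
  shows "x \<in> X closure_of (topspace X - {x})"
  unfolding in_closure_of
proof (intro conjI allI impI)
  fix T assume T: "x \<in> T \<and> openin X T"
  with assms have "T \<noteq> {x}" "T \<subseteq> topspace X" by (auto dest: openin_subset)
  with T show "\<exists>y. y \<in> topspace X - {x} \<and> y \<in> T" by blast
qed (use assms in auto)

lemma contains_Clop_fan_if_not_isolated:
  fixes X :: "'a topology"
  assumes zd: "zero_dimensional_space X" and kd: "k_discrete_space X" and t1: "t1_space X"
    and x: "x \<in> topspace X" "\<not> openin X {x}"
  shows "contains_Clop_fan TYPE('i) X"
proof -
  \<comment> \<open>Avoiding \<open>x\<close> keeps \<open>x\<close> outside the union of the
    family. Nonemptiness lets each member be labelled by one of its points.\<close>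
  define P where "P = {\<U>. disjoint \<U> \<and> (\<forall>U\<in>\<U>. clopenin X U \<and> U \<noteq> {} \<and> x \<notin> U)}"
  have "\<exists>M\<in>P. \<forall>\<U>\<in>P. M \<subseteq> \<U> \<longrightarrow> \<U> = M"
  proof (rule subset_Zorn')
    fix C assume C: "subset.chain P C"
    \<comment> \<open>Two members taken from families in a chain already lie together in the larger
      of the two families.\<close>
    have "disjnt U V" if "U \<in> \<Union>C" "V \<in> \<Union>C" "U \<noteq> V" for U V
    proof -
      obtain A B where AB: "A \<in> C" "B \<in> C" "U \<in> A" "V \<in> B" using \<open>U \<in> \<Union>C\<close> \<open>V \<in> \<Union>C\<close> by blast
      then have "A \<subseteq> B \<or> B \<subseteq> A" "A \<in> P" "B \<in> P"
        using C unfolding subset_chain_def by auto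
      then obtain D where "D \<in> P" "U \<in> D" "V \<in> D" using AB by blast
      with \<open>U \<noteq> V\<close> show ?thesis
        by (simp add: P_def pairwise_def)
    qed
    moreover have "clopenin X U \<and> U \<noteq> {} \<and> x \<notin> U" if "U \<in> \<Union>C" for U
      using C that unfolding subset_chain_def P_def by blast
    ultimately show "\<Union>C \<in> P"
      unfolding P_def pairwise_def by blast
  qed
  then obtain M where M: "M \<in> P" and max: "\<And>\<U>. \<U> \<in> P \<Longrightarrow> M \<subseteq> \<U> \<Longrightarrow> \<U> = M"
    by blast
  have disj: "disjoint M" and mem: "\<And>U. U \<in> M \<Longrightarrow> clopenin X U \<and> U \<noteq> {} \<and> x \<notin> U"
    using M unfolding P_def by auto
  \<comment> \<open>If \<open>T\<close> missed the union of \<open>M\<close>, then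
    \<open>T - {x}\<close>, nonempty because \<open>x\<close> is not isolated and open by T1, would
    contain a nonempty clopen set that could be added to \<open>M\<close>, against
    maximality.\<close>
  have dense: "\<exists>y. y \<in> \<Union>M \<and> y \<in> T" if T: "openin X T" "x \<in> T" for T
  proof (rule ccontr)
    assume none: "\<nexists>y. y \<in> \<Union>M \<and> y \<in> T"
    obtain y where "y \<in> T - {x}"
      using not_isolated_in_closure [OF x] T unfolding in_closure_of by blast
    moreover have "openin X (T - {x})"
      using T x t1 by (simp add: openin_diff closedin_t1_singleton)
    ultimately obtain V where V: "clopenin X V" "y \<in> V" "V \<subseteq> T - {x}"
      using zd unfolding zero_dimensional_space_iff by meson
    have "disjnt U V" if "U \<in> M" for U
      using that V none unfolding disjnt_def by blast
    with V disj mem have "insert V M \<in> P"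
      unfolding P_def by (auto simp: pairwise_insert disjnt_sym)
    then have "V \<in> M" using max by blast
    with V none show False by blast
  qed
  obtain p where p: "\<And>U. U \<in> M \<Longrightarrow> p U \<in> U"
    using mem by (metis ex_in_conv)
  \<comment> \<open>Disjoint members have distinct chosen points, so \<open>q\<close> is injective
    on \<open>M\<close>. The left summand \<open>'a \<times> nat\<close> thus holds the indices,
    whatever the type \<open>'i\<close> is.\<close>
  define q :: "'a set \<Rightarrow> 'a \<times> nat + 'i" where "q U = Inl (p U, 0)" for U
  have "inj_on q M"
  proof (rule inj_onI)
    fix U V assume UV: "U \<in> M" "V \<in> M" "q U = q V"
    then have "\<not> disjnt U V"
      using p [of U] p [of V] by (auto simp: q_def disjnt_def)
    with UV disj show "U = V"
      by (meson pairwiseD)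
  qed
  define F where "F = the_inv_into M q"
  have F: "F (q U) = U" if "U \<in> M" for U
    using that \<open>inj_on q M\<close> by (simp add: F_def the_inv_into_f_f)
  have field: "Field (card_of (q ` M)) = q ` M"
    by (rule Field_card_of)
  have un: "(\<Union>\<alpha>\<in>q ` M. F \<alpha>) = \<Union>M"
    using F by auto
  have "Clop_fan (card_of (q ` M)) X F"
  proof (rule Clop_fan_disjoint_family [OF kd, where x = x], unfold field un)
    show "clopenin X (F \<alpha>)" if "\<alpha> \<in> q ` M" for \<alpha>
      using that F mem by auto
    show "disjoint_family_on F (q ` M)"
      unfolding disjoint_family_on_def
    proof (intro ballI impI)
      fix \<alpha> \<beta> assume "\<alpha> \<in> q ` M" "\<beta> \<in> q ` M" "\<alpha> \<noteq> \<beta>"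
      then obtain U V where "U \<in> M" "V \<in> M" "\<alpha> = q U" "\<beta> = q V" "U \<noteq> V" by blast
      then show "F \<alpha> \<inter> F \<beta> = {}"
        using disj F by (simp add: pairwise_def disjnt_def)
    qed
    show "x \<in> X closure_of \<Union>M"
      using x dense unfolding in_closure_of by blast
    show "x \<notin> \<Union>M" using mem by blast
  qed
  then show ?thesis
    unfolding contains_Clop_fan_def using card_of_Card_order by blast
qed

text \<open>Tightness gives a countable set accumulating at \<open>x\<close>. Clopen neighborhoods
  of its points that avoid \<open>x\<close> form a sequence, which \<open>disjointed\<close> makes
  disjoint without changing the union.\<close>

lemma countable_Clop_fan_if_not_isolated:
  assumes zd: "zero_dimensional_space X" and kd: "k_discrete_space X" and t1: "t1_space X"
    and ct: "countably_tight_space X"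
    and x: "x \<in> topspace X" "\<not> openin X {x}"
  shows "\<exists>F. Clop_fan natLeq X F"
proof -
  obtain B where B: "B \<subseteq> topspace X - {x}" "countable B" "x \<in> X closure_of B"
    using ct not_isolated_in_closure [OF x] unfolding countably_tight_space_def
    by (meson Diff_subset)
  then have "B \<noteq> {}" by auto
  define b where "b = from_nat_into B"
  have b: "range b = B"
    unfolding b_def using B \<open>B \<noteq> {}\<close> by (simp add: range_from_nat_into)
  have "openin X (topspace X - {x})"
    using x t1 by (simp add: openin_diff closedin_t1_singleton)
  moreover have "b n \<in> topspace X - {x}" for n
    using b B by blast
  ultimately have "\<exists>V. clopenin X V \<and> b n \<in> V \<and> V \<subseteq> topspace X - {x}" for n
    using zd unfolding zero_dimensional_space_iff by blast
  then obtain V where V: "\<And>n. clopenin X (V n)" "\<And>n. b n \<in> V n" "\<And>n. V n \<subseteq> topspace X - {x}"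
    by metis
  have "Clop_fan natLeq X (disjointed V)"
  proof (rule Clop_fan_disjoint_family [OF kd, where x = x], unfold Field_natLeq UN_disjointed_eq)
    show "clopenin X (disjointed V n)" for n
    proof -
      \<comment> \<open>Only the finitely many earlier sets are removed from \<open>V n\<close>, so
        the difference stays clopen.\<close>
      have "openin X (\<Union>i\<in>{0..<n}. V i)" "closedin X (\<Union>i\<in>{0..<n}. V i)"
        using V(1) by (auto simp: clopenin_def intro: closedin_Union)
      then show ?thesis
        using V(1) [of n] by (simp add: clopenin_def disjointed_def openin_diff closedin_diff)
    qed
    show "disjoint_family_on (disjointed V) UNIV"
      by (rule disjoint_family_disjointed)
    have "B \<subseteq> (\<Union>n. V n)" using b V by blast
    then show "x \<in> X closure_of (\<Union>n. V n)"
      using B closure_of_mono by blast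
    show "x \<notin> (\<Union>n. V n)" using V by blast
  qed
  then show ?thesis by blast
qed

section \<open>Zero sets and strict fans of closed sets\<close>

lemma zero_set_open_if_no_strict_Cld_fan:
  assumes kd: "k_discrete_space X" and nofan: "\<nexists>F. strict_Cld_fan natLeq X F"
    and f: "continuous_map X (top_of_set {0..1::real}) f"
  shows "openin X {x \<in> topspace X. f x = 0}"
proof -
  have cf: "continuous_map X euclideanreal f" and ran: "\<And>x. x \<in> topspace X \<Longrightarrow> 0 \<le> f x \<and> f x \<le> 1"
    using f by (auto simp: continuous_map_in_subtopology Pi_iff)
  \<comment> \<open>Composed with \<open>f\<close>, this witnesses the functional neighborhoods: it
    vanishes on \<open>F n\<close>, and for \<open>n \<ge> 1\<close> the set \<open>U n\<close> on
    which it stays below 1 is the slight enlargement of \<open>F n\<close> where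
    \<open>\<bar>1 - n f\<bar> - f < 1/n\<close>.\<close>
  define h where "h n t = min 1 (real n * max 0 (\<bar>1 - real n * t\<bar> - t))" for n t
  define F where "F n = {x \<in> topspace X. \<bar>1 - real n * f x\<bar> - f x \<le> 0}" for n
  define U where "U n = {x \<in> topspace X. h n (f x) < 1}" for n
  have ch: "continuous_map X euclideanreal (\<lambda>x. h n (f x))" for n
    unfolding h_def by (intro continuous_intros cf)
  have h01: "h n t \<in> {0..1}" for n t
    unfolding h_def by auto
  have cld: "closedin X (F n)" for n
  proof -
    have "continuous_map X euclideanreal (\<lambda>x. \<bar>1 - real n * f x\<bar> - f x)"
      by (intro continuous_intros cf)
    then have "closedin X {x \<in> topspace X. \<bar>1 - real n * f x\<bar> - f x \<in> {..0}}"
      by (rule closedin_continuous_map_preimage) simp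
    then show ?thesis by (simp add: F_def)
  qed
  have fn: "functional_neighborhood X (U n) (F n)" for n
    unfolding functional_neighborhood_def
  proof (intro conjI exI [of _ "\<lambda>x. h n (f x)"])
    show "continuous_map X (top_of_set {0..1}) (\<lambda>x. h n (f x))"
      using ch h01 by (auto simp: continuous_map_in_subtopology)
    show "(\<lambda>x. h n (f x)) ` F n \<subseteq> {0}"
      by (auto simp: F_def h_def)
    show "(\<lambda>x. h n (f x)) ` (topspace X - U n) \<subseteq> {1}"
      using h01 by (auto simp: U_def not_less intro!: antisym)
  qed (auto simp: U_def)
  have Ufin: "finite {n. y \<in> U n}" if y: "y \<in> topspace X" for y
  proof -
    define t where "t = f y"
    \<comment> \<open>At \<open>t = 0\<close> the value is \<open>min 1 n\<close>, which equals 1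
      from \<open>n = 1\<close> on. For \<open>t > 0\<close> the term \<open>n t\<close> eventually
      dominates.\<close>
    obtain N where N: "\<And>n. n \<ge> N \<Longrightarrow> h n t \<ge> 1"
    proof (cases "t = 0")
      case True
      show ?thesis
        by (rule that [of 1]) (use True in \<open>auto simp: h_def\<close>)
    next
      case False
      then have t: "t > 0" using ran [OF y] by (simp add: t_def)
      \<comment> \<open>This bound gives \<open>n t - 1 - t \<ge> 1\<close>, and it also ensures
        that the factor \<open>n\<close> is at least 1.\<close>
      obtain N where N: "real N \<ge> 1 + 2 / t" using real_arch_simple by blast
      show ?thesis
      proof (rule that [of N])
        fix n assume "n \<ge> N"
        then have n: "real n \<ge> 1 + 2 / t" using N by linarith
        then have "real n * t \<ge> (1 + 2 / t) * t"
          using t by (intro mult_right_mono) auto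
        moreover have "(1 + 2 / t) * t = t + 2" using t by (simp add: field_simps)
        ultimately have "real n * t \<ge> t + 2" by simp
        then have "max 0 (\<bar>1 - real n * t\<bar> - t) \<ge> 1" by linarith
        moreover have "real n \<ge> 1"
          using n t by (smt (verit) divide_nonneg_pos)
        ultimately have "real n * max 0 (\<bar>1 - real n * t\<bar> - t) \<ge> 1 * 1"
          by (intro mult_mono) auto
        then show "h n t \<ge> 1" by (simp add: h_def)
      qed
    qed
    then have "{n. y \<in> U n} \<subseteq> {..<N}"
      by (force simp: U_def t_def not_less [symmetric])
    then show ?thesis by (rule finite_subset) simp
  qed
  have FU: "F n \<subseteq> U n" for n
    by (auto simp: F_def U_def h_def)
  have "compact_finite_family natLeq X U"
    by (rule compact_finite_familyI [OF kd]) (simp add: Field_natLeq Ufin)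
  moreover have "compact_finite_family natLeq X F"
  proof (rule compact_finite_familyI [OF kd])
    fix y assume "y \<in> topspace X"
    then have "finite {n. y \<in> F n}"
      by (rule finite_subset [OF _ Ufin, rotated]) (use FU in auto)
    then show "finite {n \<in> Field natLeq. y \<in> F n}"
      by (simp add: Field_natLeq)
  qed
  \<comment> \<open>Every other requirement for a strict fan of closed sets has been verified, so
    local finiteness is what must hold.\<close>
  ultimately have lf: "locally_finite_family natLeq X F"
    using nofan fn cld unfolding strict_Cld_fan_def strict_fan_def fan_def
    by (metis closedin_subset)
  show ?thesis
  proof (subst openin_subopen, intro ballI)
    fix x assume "x \<in> {x \<in> topspace X. f x = 0}"
    then have x: "x \<in> topspace X" "f x = 0" by auto
    obtain W where W: "openin X W" "x \<in> W" and fin: "finite {n. W \<inter> F n \<noteq> {}}"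
      using lf x unfolding locally_finite_family_def by (auto simp: Field_natLeq)
    then obtain N where "{n. W \<inter> F n \<noteq> {}} \<subseteq> {..<N}"
      using finite_nat_bounded by meson
    then have N: "\<And>n. W \<inter> F n \<noteq> {} \<Longrightarrow> n < N"
      by blast
    \<comment> \<open>On \<open>T\<close> a positive value of \<open>f\<close> would have reciprocal
      above \<open>N + 1\<close>. The corresponding point would then lie in some \<open>F n\<close>
      with \<open>n > N\<close>, whereas \<open>W\<close> meets \<open>F n\<close> for
      \<open>n < N\<close> at most.\<close>
    define T where "T = W \<inter> {y \<in> topspace X. f y \<in> {..<1 / (real N + 1)}}"
    have "openin X {y \<in> topspace X. f y \<in> {..<1 / (real N + 1)}}"
      by (rule openin_continuous_map_preimage [OF cf]) simp
    then have "openin X T" using W unfolding T_def by blast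
    moreover have "x \<in> T" using W x by (simp add: T_def)
    moreover have "f y = 0" if "y \<in> T" for y
    proof (rule ccontr)
      assume "f y \<noteq> 0"
      with that ran have y: "f y > 0" "y \<in> W" "y \<in> topspace X" "f y < 1 / (real N + 1)"
        by (auto simp: T_def less_le)
      \<comment> \<open>Rounding down gives \<open>n f(y) \<le> 1 < (n + 1) f(y)\<close>, so
        \<open>0 \<le> 1 - n f(y) < f(y)\<close> and \<open>y\<close> belongs to
        \<open>F n\<close>.\<close>
      define n where "n = nat \<lfloor>1 / f y\<rfloor>"
      have n: "real n \<le> 1 / f y" "1 / f y < real n + 1"
        unfolding n_def using y by (auto simp: floor_le_iff)
      then have "real n * f y \<le> 1" "1 < (real n + 1) * f y"
        using y by (auto simp: field_simps)
      then have "y \<in> F n"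
        using y by (simp add: F_def algebra_simps)
      then have "n < N" using N y by blast
      then have "real n + 1 \<le> real N" by simp
      moreover have "real N + 1 < 1 / f y" using y by (simp add: field_simps)
      ultimately show False using n by linarith
    qed
    moreover have "T \<subseteq> topspace X" by (auto simp: T_def)
    ultimately show "\<exists>T. openin X T \<and> x \<in> T \<and> T \<subseteq> {x \<in> topspace X. f x = 0}"
      by blast
  qed
qed

text \<open>A function separating \<open>x\<close> from the complement of \<open>U\<close> has a
  zero set that contains \<open>x\<close>, lies inside \<open>U\<close>, and is clopen: closed by
  continuity, open by the preceding lemma.\<close>

lemma zero_dimensional_if_no_strict_Cld_fan:
  assumes cr: "completely_regular_space X" and kd: "k_discrete_space X"
    and nofan: "\<nexists>F. strict_Cld_fan natLeq X F"
  shows "zero_dimensional_space X"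
  unfolding zero_dimensional_space_iff
proof (intro allI impI)
  fix U x assume U: "openin X U \<and> x \<in> U"
  then have "closedin X (topspace X - U)" "x \<in> topspace X - (topspace X - U)"
    by (auto dest: openin_subset)
  then obtain f where f: "continuous_map X (top_of_set {0..1::real}) f" "f x = 0"
    and f1: "f ` (topspace X - U) \<subseteq> {1}"
    using cr unfolding completely_regular_space_def by blast
  let ?Z = "{x \<in> topspace X. f x = 0}"
  have "closedin X {x \<in> topspace X. f x \<in> {0}}"
    using f(1) by (intro closedin_continuous_map_preimage [of X euclideanreal])
      (auto simp: continuous_map_in_subtopology)
  then have "clopenin X ?Z"
    using zero_set_open_if_no_strict_Cld_fan [OF kd nofan f(1)] by (simp add: clopenin_def)
  moreover have "x \<in> ?Z" using U f openin_subset by fastforce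
  moreover have "?Z \<subseteq> U" using f1 by (fastforce simp: image_subset_iff)
  ultimately show "\<exists>V. clopenin X V \<and> x \<in> V \<and> V \<subseteq> U" by blast
qed

section \<open>Discrete spaces and the equivalences\<close>

text \<open>A singleton is both compact and open here, so compact-finiteness tested on
  \<open>{x}\<close> is already local finiteness at \<open>x\<close>.\<close>

lemma no_fan_discrete_topology: "\<not> fan lam (discrete_topology S) F"
proof
  assume fan: "fan lam (discrete_topology S) F"
  have "locally_finite_family lam (discrete_topology S) F"
    unfolding locally_finite_family_def
  proof
    fix x assume "x \<in> topspace (discrete_topology S)"
    then have "openin (discrete_topology S) {x}" "compactin (discrete_topology S) {x}"
      by auto
    with fan show "\<exists>W. openin (discrete_topology S) W \<and> x \<in> W \<and>
        finite {\<alpha> \<in> Field lam. W \<inter> F \<alpha> \<noteq> {}}"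
      unfolding fan_def compact_finite_family_def by blast
  qed
  with fan show False by (simp add: fan_def)
qed

lemma zero_dimensional_discrete_topology: "zero_dimensional_space (discrete_topology S)"
  unfolding zero_dimensional_space_iff clopenin_def by auto

lemma k_discrete_discrete_topology: "k_discrete_space (discrete_topology S)"
  by (simp add: k_discrete_space_def compactin_discrete_topology)

lemma countably_tight_discrete_topology: "countably_tight_space (discrete_topology S)"
  unfolding countably_tight_space_def
proof (intro allI impI)
  fix A a
  assume "A \<subseteq> topspace (discrete_topology S) \<and> a \<in> discrete_topology S closure_of A"
  then have "a \<in> A" "a \<in> discrete_topology S closure_of {a}"
    by (auto simp: discrete_topology_closure_of)
  then show "\<exists>B\<subseteq>A. countable B \<and> a \<in> discrete_topology S closure_of B"
    by (intro exI [of _ "{a}"]) auto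
qed

theorem theorem1p4:
  fixes X :: "'a topology"
  assumes "tychonoff_space X"
  shows
    "(X = discrete_topology (topspace X) \<longleftrightarrow>
        zero_dimensional_space X \<and> k_discrete_space X \<and> countably_tight_space X \<and>
        \<not> (\<exists>F. Clop_fan natLeq X F)) \<and>
     (X = discrete_topology (topspace X) \<longleftrightarrow>
        zero_dimensional_space X \<and> k_discrete_space X \<and>
        \<not> contains_Clop_fan TYPE('i) X) \<and>
     (X = discrete_topology (topspace X) \<longleftrightarrow>
        k_discrete_space X \<and> \<not> (\<exists>F. strict_Cld_fan natLeq X F) \<and>
        \<not> contains_Clop_fan TYPE('i) X)"
proof -
  have cr: "completely_regular_space X" and t1: "t1_space X"
    using assms by (auto simp: tychonoff_space_def Hausdorff_imp_t1_space)
  have disc: "X = discrete_topology (topspace X) \<longleftrightarrow> (\<forall>x\<in>topspace X. openin X {x})"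
    using discrete_topology_unique [of "topspace X" X] by (simp add: eq_commute)
  have fwd: "zero_dimensional_space X \<and> k_discrete_space X \<and> countably_tight_space X \<and>
      \<not> (\<exists>F. Clop_fan natLeq X F) \<and> \<not> (\<exists>F. strict_Cld_fan natLeq X F) \<and>
      \<not> contains_Clop_fan TYPE('i) X"
    if X: "X = discrete_topology (topspace X)"
  proof -
    have "\<not> fan natLeq X F" for F
      using no_fan_discrete_topology X by metis
    moreover have "\<not> fan lam X F" for lam :: "('a \<times> nat + 'i) rel" and F
      using no_fan_discrete_topology X by metis
    moreover have "zero_dimensional_space X" "k_discrete_space X" "countably_tight_space X"
      by (subst X, rule zero_dimensional_discrete_topology k_discrete_discrete_topology
          countably_tight_discrete_topology)+
    ultimately show ?thesis
      by (auto simp: Clop_fan_def strict_Cld_fan_def strict_fan_def contains_Clop_fan_def)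
  qed
  have 2: "X = discrete_topology (topspace X)"
    if "zero_dimensional_space X" "k_discrete_space X" "countably_tight_space X"
      "\<not> (\<exists>F. Clop_fan natLeq X F)"
    unfolding disc using countable_Clop_fan_if_not_isolated [of X] t1 that by metis
  have 3: "X = discrete_topology (topspace X)"
    if "zero_dimensional_space X" "k_discrete_space X" "\<not> contains_Clop_fan TYPE('i) X"
    unfolding disc using contains_Clop_fan_if_not_isolated [of X, where 'i = 'i] t1 that by metis
  \<comment> \<open>Excluding strict fans yields zero-dimensionality, which reduces this case to the
    previous one.\<close>
  have 4: "X = discrete_topology (topspace X)"
    if "k_discrete_space X" "\<not> (\<exists>F. strict_Cld_fan natLeq X F)" "\<not> contains_Clop_fan TYPE('i) X"
    by (rule 3) (use zero_dimensional_if_no_strict_Cld_fan [OF cr] that in auto)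
  show ?thesis
    apply (intro conjI; rule iffI)
    subgoal by (drule fwd) (elim conjE, intro conjI)
    subgoal by (elim conjE, rule 2)
    subgoal by (drule fwd) (elim conjE, intro conjI)
    subgoal by (elim conjE, rule 3)
    subgoal by (drule fwd) (elim conjE, intro conjI)
    subgoal by (elim conjE, rule 4)
    done
qed

end
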